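(* Let $T = [0,1]$ (the real unit interval) be the semiring equipped with addition $a \oplus b = \max(a,b)$ and multiplication defined by $a \odot b = 0$ for all $a,b \in [0,1)$, with $1 \odot a = a \odot 1 = a$ for all $a \in T$. The following statements hold: (1) The set of ideals of $T$ is $\operatorname{Id}(T) = \{T\} \cup \{ I \subseteq [0, 1) : 0 \in I \}$. (2) An ideal $I \in \operatorname{Id}(T)$ is subtractive if and only if $I = T$, or $I = [0, c]$ for some $c \in [0, 1)$, or $I = [0, c)$ for some $c \in (0, 1]$. (3) For any ideal $I \in \operatorname{Id}(T)$, its subtractive closure is given by \[ \operatorname{scl}_T(I) = \begin{cases} [0, \sup I], & \text{if } \sup I \in I, \\ [0, \sup I), & \text{if } \sup I \notin I. \end{cases} \]
   Context: The additive identity (zero) of $T$ is the number $0$ and the multiplicative identity is the number $1$. An ideal of a commutative semiring $S$ (with operations $+,\cdot$) is a nonempty subset $I$ with $a+b\in I$ and $sa\in I$ for all $a,b\in I$, $s\in S$. An ideal $I$ is subtractive if $x+y\in I$ and $x\in I$ imply $y\in I$, for all $x,y\in S$. The subtractive closure $\operatorname{scl}_S(I)$ of $I$ is the intersection of all subtractive ideals of $S$ containing $I$. *)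

theory Defs
  imports Complex_Main "HOL-Algebra.Ring"
begin

text \<open>Semirings are the ones of the \<^locale>\<open>semiring\<close> locale. The library's ideals are ideals of
  rings (additive subgroups), hence the notion for commutative semirings is defined here.\<close>

definition semiring_ideal :: "('a, 'm) ring_scheme \<Rightarrow> 'a set \<Rightarrow> bool" where
  "semiring_ideal S I \<longleftrightarrow>
     I \<subseteq> carrier S \<and> I \<noteq> {} \<and>
     (\<forall>a\<in>I. \<forall>b\<in>I. a \<oplus>\<^bsub>S\<^esub> b \<in> I) \<and>
     (\<forall>s\<in>carrier S. \<forall>a\<in>I. s \<otimes>\<^bsub>S\<^esub> a \<in> I)"

definition Ideals :: "('a, 'm) ring_scheme \<Rightarrow> 'a set set" where
  "Ideals S = {I. semiring_ideal S I}"

definition subtractive :: "('a, 'm) ring_scheme \<Rightarrow> 'a set \<Rightarrow> bool" where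
  "subtractive S I \<longleftrightarrow>
     (\<forall>x\<in>carrier S. \<forall>y\<in>carrier S. x \<oplus>\<^bsub>S\<^esub> y \<in> I \<and> x \<in> I \<longrightarrow> y \<in> I)"

text \<open>The intersected family is never empty: it contains \<^term>\<open>carrier S\<close> for every semiring \<open>S\<close>.\<close>

definition scl :: "('a, 'm) ring_scheme \<Rightarrow> 'a set \<Rightarrow> 'a set" where
  "scl S I = \<Inter> {J \<in> Ideals S. subtractive S J \<and> I \<subseteq> J}"

definition T :: "real ring" where
  "T = \<lparr>carrier = {0..1},
        mult = (\<lambda>a b. if a = 1 then b else if b = 1 then a else 0),
        one = 1, zero = 0, add = max\<rparr>"

lemma semiring_T: "semiring T"
  by unfold_locales (auto simp: T_def Units_def max_def)

lemma comm_monoid_T: "comm_monoid T"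
  by unfold_locales (auto simp: T_def)

end

theory Submission
  imports Defs
begin

text \<open>Every ideal is closed under \<^const>\<open>max\<close> for trivial reasons, and the subtractive ones are
  exactly those closed downwards. Hence the subtractive closure of an ideal is its downward
  closure, an interval determined by the supremum.\<close>

text \<open>Multiples of \<open>1\<close> exhaust the carrier, so only the whole carrier can contain
  \<open>1\<close>. Below \<open>1\<close>, multiplying an element by any scalar yields that element
  or \<open>0\<close>, so \<open>0 \<in> I\<close> already gives absorption.\<close>

lemma Ideals_T: "Ideals T = {carrier T} \<union> {I. I \<subseteq> {0..<1} \<and> 0 \<in> I}"
proof (intro equalityI subsetI)
  fix I assume "I \<in> Ideals T"
  then have sub: "I \<subseteq> {0..1}" and "I \<noteq> {}"
    and mult: "\<And>s a. s \<in> {0..1} \<Longrightarrow> a \<in> I \<Longrightarrow> (if s = 1 then a else if a = 1 then s else 0) \<in> I"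
    by (auto simp: Ideals_def semiring_ideal_def T_def)
  then obtain a where "a \<in> I" by blast
  \<comment> \<open>The product of \<open>0\<close> and \<open>a\<close> is \<open>0\<close> whether
    or not \<open>a = 1\<close>.\<close>
  with mult[of 0 a] have zero: "0 \<in> I" by (simp split: if_splits)
  show "I \<in> {carrier T} \<union> {I. I \<subseteq> {0..<1} \<and> 0 \<in> I}"
  proof (cases "1 \<in> I")
    case True
    then have "s \<in> I" if "s \<in> {0..1}" for s
      using mult[OF that True] by (simp split: if_splits)
    with sub have "I = carrier T" by (auto simp: T_def)
    then show ?thesis by simp
  next
    case False
    then have "I \<subseteq> {0..<1}"
      using sub by (force simp: less_le)
    with zero show ?thesis by simp
  qed
next
  fix I assume "I \<in> {carrier T} \<union> {I. I \<subseteq> {0..<1} \<and> 0 \<in> I}"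
  then show "I \<in> Ideals T"
  proof
    assume "I \<in> {carrier T}"
    then show ?thesis
      by (auto simp: Ideals_def semiring_ideal_def T_def)
  next
    assume "I \<in> {I. I \<subseteq> {0..<1} \<and> 0 \<in> I}"
    then show ?thesis
      by (auto simp: Ideals_def semiring_ideal_def T_def max_def subset_iff)
  qed
qed

lemma Ideals_T_D:
  assumes "I \<in> Ideals T"
  shows "I \<subseteq> {0..1}" and "0 \<in> I"
  using assms unfolding Ideals_T by (auto simp: T_def)

text \<open>If \<open>y \<le> z\<close>, then \<open>z\<close> absorbs \<open>y\<close> under
  \<open>max\<close>, so subtractivity at \<open>x = z\<close> yields \<open>y\<close>. Conversely,
  \<open>y\<close> always lies below \<open>max x y\<close>.\<close>

lemma subtractive_T_iff:
  assumes "I \<in> Ideals T"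
  shows "subtractive T I \<longleftrightarrow> (\<forall>z\<in>I. {0..z} \<subseteq> I)"
proof
  assume sub: "subtractive T I"
  show "\<forall>z\<in>I. {0..z} \<subseteq> I"
  proof (intro ballI subsetI)
    fix z y assume "z \<in> I" "y \<in> {0..z}"
    moreover from this have "max z y = z" by simp
    ultimately show "y \<in> I"
      using sub Ideals_T_D(1)[OF assms] unfolding subtractive_def T_def by force
  qed
next
  assume "\<forall>z\<in>I. {0..z} \<subseteq> I"
  then show "subtractive T I"
    unfolding subtractive_def T_def by fastforce
qed

lemma interval_Sup_eq:
  fixes I :: "real set"
  assumes "I \<noteq> {}" "bdd_above I"
  shows "(if Sup I \<in> I then {0..Sup I} else {0..<Sup I}) = (\<Union>z\<in>I. {0..z})"
proof -
  have less: "x < Sup I \<longleftrightarrow> (\<exists>z\<in>I. x < z)" for x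
    using assms by (rule less_cSup_iff)
  have upper: "z \<le> Sup I" if "z \<in> I" for z
    using that assms(2) by (rule cSup_upper)
  show ?thesis
  proof (cases "Sup I \<in> I")
    case True
    then show ?thesis
      by (auto intro: order_trans[OF _ upper])
  next
    case False
    then have "z < Sup I" if "z \<in> I" for z
      using upper[OF that] that by (metis less_le)
    \<comment> \<open>With the supremum not attained, \<open>x \<le> z\<close> already forces
      \<open>x < Sup I\<close>, so weak and strict domination by elements of \<open>I\<close>
      agree.\<close>
    then have "x < Sup I \<longleftrightarrow> (\<exists>z\<in>I. x \<le> z)" for x
      using less by (meson le_less_trans less_imp_le)
    with False show ?thesis by auto
  qed
qed

text \<open>The downward closure \<open>?D\<close> is itself a member of the intersected family, and
  by \<open>subtractive_T_iff\<close> every member contains it.\<close>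

lemma scl_T:
  assumes "I \<in> Ideals T"
  shows "scl T I = (\<Union>z\<in>I. {0..z})" (is "_ = ?D")
proof
  have "?D \<in> Ideals T"
  \<comment> \<open>The downward closure acquires \<open>1\<close> only if \<open>I\<close> already
    contains it, so both shapes in \<open>Ideals_T\<close> are preserved.\<close>
  proof (cases "I = carrier T")
    case True
    then have "?D = carrier T" by (force simp: T_def)
    then show ?thesis by (simp add: Ideals_T)
  next
    case False
    with assms have "I \<subseteq> {0..<1}" "0 \<in> I" by (auto simp: Ideals_T)
    then have "?D \<subseteq> {0..<1}" "0 \<in> ?D" by force+
    then show ?thesis by (simp add: Ideals_T)
  qed
  moreover from this have "subtractive T ?D"
    by (fastforce simp: subtractive_T_iff)
  moreover have "I \<subseteq> ?D"
    using Ideals_T_D(1)[OF assms] by force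
  ultimately show "scl T I \<subseteq> ?D"
    unfolding scl_def by blast
next
  show "?D \<subseteq> scl T I"
    unfolding scl_def using subtractive_T_iff by blast
qed

text \<open>A subtractive ideal equals its own downward closure, so \<open>interval_Sup_eq\<close>
  makes it an interval ending at \<open>Sup I\<close>.\<close>

lemma subtractive_T_cases:
  assumes "I \<in> Ideals T"
  shows "subtractive T I \<longleftrightarrow>
    I = carrier T \<or> (\<exists>c\<in>{0..<1}. I = {0..c}) \<or> (\<exists>c\<in>{0<..1}. I = {0..<c})"
proof
  assume "subtractive T I"
  then have eq: "I = (\<Union>z\<in>I. {0..z})"
    using assms Ideals_T_D(1)[OF assms] by (force simp: subtractive_T_iff)
  have I: "I \<noteq> {}" "bdd_above I"
    using Ideals_T_D[OF assms] by (auto intro: bdd_above_mono)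
  have Sup: "0 \<le> Sup I" "Sup I \<le> 1"
    using Ideals_T_D[OF assms] I by (auto intro!: cSup_upper cSup_least)
  have cases: "I = (if Sup I \<in> I then {0..Sup I} else {0..<Sup I})"
    using eq interval_Sup_eq[OF I] by simp
  show "I = carrier T \<or> (\<exists>c\<in>{0..<1}. I = {0..c}) \<or> (\<exists>c\<in>{0<..1}. I = {0..<c})"
  proof (cases "Sup I \<in> I")
    case True
    with cases have "I = {0..Sup I}" by simp
    with Sup show ?thesis
      \<comment> \<open>The closed interval ending at \<open>1\<close> is the carrier; any other
        endpoint is a valid \<open>c < 1\<close>.\<close>
      by (cases "Sup I = 1") (auto simp: T_def)
  next
    case False
    with cases have "I = {0..<Sup I}" by simp
    \<comment> \<open>Since \<open>0 \<in> I\<close>, a supremum equal to \<open>0\<close> would be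
      attained.\<close>
    moreover have "Sup I \<noteq> 0"
      using False Ideals_T_D(2)[OF assms] by auto
    ultimately show ?thesis
      using Sup by (metis greaterThanAtMost_iff less_le)
  qed
next
  assume "I = carrier T \<or> (\<exists>c\<in>{0..<1}. I = {0..c}) \<or> (\<exists>c\<in>{0<..1}. I = {0..<c})"
  then show "subtractive T I"
    unfolding subtractive_T_iff[OF assms] by (auto simp: T_def)
qed

theorem theorem3p9:
  "Ideals T = {carrier T} \<union> {I. I \<subseteq> {0..<1} \<and> 0 \<in> I}
   \<and> (\<forall>I\<in>Ideals T. subtractive T I \<longleftrightarrow>
         I = carrier T \<or> (\<exists>c\<in>{0..<1}. I = {0..c}) \<or> (\<exists>c\<in>{0<..1}. I = {0..<c}))
   \<and> (\<forall>I\<in>Ideals T. scl T I = (if Sup I \<in> I then {0..Sup I} else {0..<Sup I}))"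
proof (intro conjI ballI)
  show "Ideals T = {carrier T} \<union> {I. I \<subseteq> {0..<1} \<and> 0 \<in> I}"
    by (rule Ideals_T)
next
  fix I assume "I \<in> Ideals T"
  then show "subtractive T I \<longleftrightarrow>
      I = carrier T \<or> (\<exists>c\<in>{0..<1}. I = {0..c}) \<or> (\<exists>c\<in>{0<..1}. I = {0..<c})"
    by (rule subtractive_T_cases)
next
  fix I assume I: "I \<in> Ideals T"
  \<comment> \<open>These conditions make \<open>Sup I\<close> a genuine least upper bound in the
    reals.\<close>
  have "I \<noteq> {}" "bdd_above I"
    using Ideals_T_D[OF I] by (auto intro: bdd_above_mono)
  then show "scl T I = (if Sup I \<in> I then {0..Sup I} else {0..<Sup I})"
    unfolding scl_T[OF I] by (rule interval_Sup_eq[symmetric])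
qed

end
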